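(* Let $X$ be a non-negative random variable with interval support, quantile function $F^{-1}$ and hazard rate $r$. (A) Suppose $r$ is UBT, with its maximum attained at $F^{-1}(p^* )$, $p^*\in(0,1)$. Then: (A1) $X$ is IFRA if, and only if, $$\lim_{p\to0^+}\bigl(F^{-1}(p)\,r(F^{-1}(p))+\log(1-p)\bigr)\ge0\quad\text{and}\quad\lim_{p\to1^-}\bigl(F^{-1}(p)\,r(F^{-1}(p))+\log(1-p)\bigr)\ge0;$$ (A2) $X$ is DFRA if, and only if, $F^{-1}(p^* )\,r(F^{-1}(p^* ))+\log(1-p^* )\le0$. (B) Suppose $r$ is BT, with its minimum attained at $F^{-1}(p^* )$, $p^*\in(0,1)$. Then: (B1) $X$ is DFRA if, and only if, $$\lim_{p\to0^+}\bigl(F^{-1}(p)\,r(F^{-1}(p))+\log(1-p)\bigr)\le0\quad\text{and}\quad\lim_{p\to1^-}\bigl(F^{-1}(p)\,r(F^{-1}(p))+\log(1-p)\bigr)\le0;$$ (B2) $X$ is IFRA if, and only if, $F^{-1}(p^* )\,r(F^{-1}(p^* ))+\log(1-p^* )\ge0$.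
   Context: Standing assumptions: $X$ is non-negative and continuous, with finite expectation, distribution function $F$, density function $f$ and interval support $(l_X,u_X)$ (bounded or unbounded). The quantile function is $F^{-1}(p)=\inf\{x\in\mathbb R:F(x)\ge p\}$, $p\in(0,1)$, assumed differentiable with derivative $1/f(F^{-1}(p))$. The hazard rate is $r=f/\overline F$, where $\overline F=1-F$. "Increasing" and "decreasing" are used in the non-strict sense. The hazard rate is bathtub (BT) if, over the support, it starts decreasing and ends increasing, i.e. there is an interior point such that it is decreasing before this point and increasing after it; it is upside-down bathtub (UBT) if it starts increasing and ends decreasing, i.e. there is an interior point such that it is increasing before this point and decreasing after it. $X$ is IFRA [DFRA] if $\frac1t\int_0^t r(x)\,dx$ is increasing [decreasing] in $t$; equivalently, if $-\log(1-p)/F^{-1}(p)$ is increasing [decreasing] in $p\in(0,1)$ (i.e. $X\le_\star Y$ [$X\ge_\star Y$] in the star-shaped order for $Y$ exponential with scale parameter 1). Limits are taken in the extended reals. *)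

theory Defs
  imports "HOL-Probability.Probability"
begin

text \<open>The topological support. It is a closed set, so a random variable with "interval support
  \<open>(l, u)\<close>" is one whose support is the closure of \<open>(l, u)\<close>; the end points are extended reals.\<close>

definition msupport :: "'a::topological_space measure \<Rightarrow> 'a set" where
  "msupport N = {x. \<forall>S. open S \<longrightarrow> x \<in> S \<longrightarrow> 0 < emeasure N S}"

definition interval_support :: "real measure \<Rightarrow> ereal \<Rightarrow> ereal \<Rightarrow> bool" where
  "interval_support N l u \<longleftrightarrow> l < u \<and> msupport N = closure (einterval l u)"

definition quantile :: "(real \<Rightarrow> real) \<Rightarrow> real \<Rightarrow> real" where
  "quantile F p = Inf {x. p \<le> F x}"

definition hazard_rate :: "(real \<Rightarrow> real) \<Rightarrow> (real \<Rightarrow> real) \<Rightarrow> real \<Rightarrow> real" where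
  "hazard_rate f F x = f x / (1 - F x)"

definition bathtub :: "real set \<Rightarrow> (real \<Rightarrow> real) \<Rightarrow> bool" where
  "bathtub S r \<longleftrightarrow> (\<exists>c\<in>interior S. antimono_on (S \<inter> {..<c}) r \<and> mono_on (S \<inter> {c<..}) r)"

definition upside_down_bathtub :: "real set \<Rightarrow> (real \<Rightarrow> real) \<Rightarrow> bool" where
  "upside_down_bathtub S r \<longleftrightarrow>
     (\<exists>c\<in>interior S. mono_on (S \<inter> {..<c}) r \<and> antimono_on (S \<inter> {c<..}) r)"

text \<open>The average hazard rate over \<open>(0, t)\<close> is considered for those \<open>t > 0\<close> with \<open>F t < 1\<close>: from the
  point where \<open>F\<close> reaches \<open>1\<close> on, the hazard rate is undefined.\<close>

definition IFRA :: "(real \<Rightarrow> real) \<Rightarrow> (real \<Rightarrow> real) \<Rightarrow> bool" where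
  "IFRA f F \<longleftrightarrow>
     mono_on {t. 0 < t \<and> F t < 1} (\<lambda>t. (1 / t) * (LBINT x=0..t. hazard_rate f F x))"

definition DFRA :: "(real \<Rightarrow> real) \<Rightarrow> (real \<Rightarrow> real) \<Rightarrow> bool" where
  "DFRA f F \<longleftrightarrow>
     antimono_on {t. 0 < t \<and> F t < 1} (\<lambda>t. (1 / t) * (LBINT x=0..t. hazard_rate f F x))"

end

theory Submission
  imports Defs
begin

text \<open>
  On the interior of the support the cumulative hazard \<open>H = - ln (1 - F)\<close> has derivative \<open>r\<close>, and
  the average hazard rate over \<open>(0, t)\<close> is \<open>H t / t\<close>, with derivative \<open>(t r(t) - H t) / t\<^sup>2\<close>. Hence
  IFRA and DFRA are sign conditions on the excess \<open>t r(t) - H t\<close>, which at \<open>t = Q p\<close> is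
  \<open>Q p r(Q p) + ln (1 - p)\<close>. By the mean value theorem for \<open>H\<close> the excess increases or decreases
  together with \<open>r\<close>. If \<open>r\<close> is upside-down bathtub, the excess is therefore unimodal with the same
  maximum point: it is nonpositive iff it is so at the maximum, and nonnegative iff its limits at the
  two ends are. The bathtub case follows by passing to \<open>- r\<close> and \<open>- H\<close>.
\<close>

section \<open>One-sided limits and signs of unimodal functions\<close>

text \<open>A value \<open>g c\<close> below a given bound caps all values on the side of
  \<open>c\<close> facing the end point. Extended real values make the infimum a limit even when
  \<open>g\<close> is unbounded below.\<close>

lemma INF_tendsto_at_right:
  fixes g :: "real \<Rightarrow> ereal"
  assumes "mono_on {a<..b} g" "a < b"
  shows "(g \<longlongrightarrow> (INF x\<in>{a<..b}. g x)) (at_right a)"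
proof (rule order_tendstoI)
  fix y assume y: "y < (INF x\<in>{a<..b}. g x)"
  have "\<forall>\<^sub>F x in at_right a. x \<in> {a<..<b}"
    using assms(2) by (intro eventually_at_rightI[of a b]) auto
  then show "\<forall>\<^sub>F x in at_right a. y < g x"
    by eventually_elim (auto intro!: less_le_trans[OF y] INF_lower)
next
  fix y assume "(INF x\<in>{a<..b}. g x) < y"
  then obtain c where c: "c \<in> {a<..b}" "g c < y" by (auto simp: INF_less_iff)
  have "\<forall>\<^sub>F x in at_right a. x \<in> {a<..<c}"
    using c(1) by (intro eventually_at_rightI[of _ c]) auto
  then show "\<forall>\<^sub>F x in at_right a. g x < y"
    by eventually_elim (use c in \<open>auto intro!: le_less_trans[OF _ c(2)] mono_onD[OF assms(1)]\<close>)
qed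

lemma INF_tendsto_at_left:
  fixes g :: "real \<Rightarrow> ereal"
  assumes "antimono_on {a..<b} g" "a < b"
  shows "(g \<longlongrightarrow> (INF x\<in>{a..<b}. g x)) (at_left b)"
proof (rule order_tendstoI)
  fix y assume y: "y < (INF x\<in>{a..<b}. g x)"
  have "\<forall>\<^sub>F x in at_left b. x \<in> {a<..<b}"
    using assms(2) by (intro eventually_at_leftI[of a b]) auto
  then show "\<forall>\<^sub>F x in at_left b. y < g x"
    by eventually_elim (auto intro!: less_le_trans[OF y] INF_lower)
next
  fix y assume "(INF x\<in>{a..<b}. g x) < y"
  then obtain c where c: "c \<in> {a..<b}" "g c < y" by (auto simp: INF_less_iff)
  have "\<forall>\<^sub>F x in at_left b. x \<in> {c<..<b}"
    using c(1) by (intro eventually_at_leftI[of c]) auto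
  then show "\<forall>\<^sub>F x in at_left b. g x < y"
    by eventually_elim (use c in \<open>auto intro!: le_less_trans[OF _ c(2)] monotone_onD[OF assms(1)]\<close>)
qed

text \<open>The limits at the two ends are the infima of the two monotone branches, so nonnegativity
  everywhere is nonnegativity of both limits. The branches share the point \<open>p\<close>, where
  the maximum sits, and this settles the opposite sign.\<close>

lemma unimodal_sign:
  fixes \<phi> :: "real \<Rightarrow> real"
  assumes p: "p \<in> {a<..<b}" and up: "mono_on {a<..p} \<phi>" and down: "antimono_on {p..<b} \<phi>"
  shows "\<exists>L0 L1 :: ereal. ((\<lambda>x. ereal (\<phi> x)) \<longlongrightarrow> L0) (at_right a) \<and>
           ((\<lambda>x. ereal (\<phi> x)) \<longlongrightarrow> L1) (at_left b) \<and>
           ((\<forall>x\<in>{a<..<b}. 0 \<le> \<phi> x) \<longleftrightarrow> 0 \<le> L0 \<and> 0 \<le> L1)"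
    and "(\<forall>x\<in>{a<..<b}. \<phi> x \<le> 0) \<longleftrightarrow> \<phi> p \<le> 0"
proof -
  have "{a<..<b} = {a<..p} \<union> {p..<b}" using p by auto
  then have "(\<forall>x\<in>{a<..<b}. 0 \<le> \<phi> x) \<longleftrightarrow>
      0 \<le> (INF x\<in>{a<..p}. ereal (\<phi> x)) \<and> 0 \<le> (INF x\<in>{p..<b}. ereal (\<phi> x))"
    by (auto simp: le_INF_iff)
  moreover have "((\<lambda>x. ereal (\<phi> x)) \<longlongrightarrow> (INF x\<in>{a<..p}. ereal (\<phi> x))) (at_right a)"
    by (rule INF_tendsto_at_right) (use p up in \<open>auto simp: monotone_on_def\<close>)
  moreover have "((\<lambda>x. ereal (\<phi> x)) \<longlongrightarrow> (INF x\<in>{p..<b}. ereal (\<phi> x))) (at_left b)"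
    by (rule INF_tendsto_at_left) (use p down in \<open>auto simp: monotone_on_def\<close>)
  ultimately show "\<exists>L0 L1 :: ereal. ((\<lambda>x. ereal (\<phi> x)) \<longlongrightarrow> L0) (at_right a) \<and>
           ((\<lambda>x. ereal (\<phi> x)) \<longlongrightarrow> L1) (at_left b) \<and>
           ((\<forall>x\<in>{a<..<b}. 0 \<le> \<phi> x) \<longleftrightarrow> 0 \<le> L0 \<and> 0 \<le> L1)"
    by blast
  have "\<phi> x \<le> \<phi> p" if "x \<in> {a<..<b}" for x
    using that p monotone_onD[OF up, of x p] monotone_onD[OF down, of p x] by fastforce
  then show "(\<forall>x\<in>{a<..<b}. \<phi> x \<le> 0) \<longleftrightarrow> \<phi> p \<le> 0"
    using p by force
qed

section \<open>Shape of the excess \<open>x * r x - H x\<close>\<close>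

text \<open>A derivative cannot drop at a single point. If \<open>r c < K\<close>, then
  \<open>H x - K * x\<close> would be strictly decreasing into \<open>c\<close>, although its
  derivative is nonnegative on the left of \<open>c\<close>.\<close>

lemma derivative_ge_of_left:
  fixes H r :: "real \<Rightarrow> real"
  assumes "a < c" and H: "\<And>x. x \<in> {a..c} \<Longrightarrow> (H has_real_derivative r x) (at x)"
    and K: "\<And>x. x \<in> {a<..<c} \<Longrightarrow> K \<le> r x"
  shows "K \<le> r c"
proof (rule ccontr)
  assume "\<not> K \<le> r c"
  have D: "((\<lambda>x. H x - K * x) has_real_derivative r x - K) (at x)" if "x \<in> {a..c}" for x
    using H[OF that] by (auto intro!: derivative_eq_intros)
  have "\<exists>d>0. \<forall>h>0. h < d \<longrightarrow> H c - K * c < H (c - h) - K * (c - h)"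
    by (rule DERIV_neg_dec_left[OF D]) (use \<open>a < c\<close> \<open>\<not> K \<le> r c\<close> in auto)
  then obtain d where d: "d > 0"
    "\<And>h. h > 0 \<Longrightarrow> h < d \<Longrightarrow> H c - K * c < H (c - h) - K * (c - h)" by blast
  \<comment> \<open>Halving gives \<open>h < d\<close>, and the second bound keeps
    \<open>c - h\<close> in the interval.\<close>
  define h where "h = min (d / 2) (c - a)"
  have h: "0 < h" "h < d" "a \<le> c - h" using d(1) \<open>a < c\<close> by (auto simp: h_def)
  have "H (c - h) - K * (c - h) \<le> H c - K * c"
  proof (rule DERIV_nonneg_imp_increasing_open[where f = "\<lambda>x. H x - K * x"])
    show "\<exists>y. ((\<lambda>x. H x - K * x) has_real_derivative y) (at x) \<and> 0 \<le> y"
      if "c - h < x" "x < c" for x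
      using D[of x] K[of x] that h by (intro exI[of _ "r x - K"]) auto
    show "continuous_on {c - h..c} (\<lambda>x. H x - K * x)"
      using h by (intro continuous_at_imp_continuous_on ballI DERIV_isCont[OF D]) auto
  qed (use h in auto)
  with d(2)[OF h(1,2)] show False by linarith
qed

text \<open>Reflection at the origin: \<open>- H (- x)\<close> has derivative
  \<open>r (- x)\<close>, which turns right neighbourhoods into left ones.\<close>

lemma derivative_ge_of_right:
  fixes H r :: "real \<Rightarrow> real"
  assumes "c < b" and H: "\<And>x. x \<in> {c..b} \<Longrightarrow> (H has_real_derivative r x) (at x)"
    and K: "\<And>x. x \<in> {c<..<b} \<Longrightarrow> K \<le> r x"
  shows "K \<le> r c"
proof -
  have "((\<lambda>x. - H (- x)) has_real_derivative r (- x)) (at x)" if "x \<in> {- b..- c}" for x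
  proof -
    have "(H has_real_derivative r (- x)) (at (- x))" using that by (intro H) auto
    from DERIV_minus[OF DERIV_chain2[OF this DERIV_minus[OF DERIV_ident]]]
    show ?thesis by simp
  qed
  from derivative_ge_of_left[of "- b" "- c" "\<lambda>x. - H (- x)" "\<lambda>x. r (- x)" K, OF _ this] assms
  show ?thesis by auto
qed

text \<open>Write \<open>t * r t - s * r s\<close> as
  \<open>(t - s) * r t + s * (r t - r s)\<close>. The first term dominates \<open>H t - H s\<close>
  by the mean value theorem, the second is nonnegative because \<open>0 \<le> s\<close>. Thus
  \<open>r\<close> itself is never differentiated.\<close>

lemma mono_on_excess:
  fixes H r :: "real \<Rightarrow> real"
  assumes T: "is_interval T" "T \<subseteq> {0..}"
    and H: "\<And>x. x \<in> T \<Longrightarrow> (H has_real_derivative r x) (at x)" and r: "mono_on T r"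
  shows "mono_on T (\<lambda>x. x * r x - H x)"
proof (rule mono_onI)
  fix s t assume st: "s \<in> T" "t \<in> T" "s \<le> t"
  show "s * r s - H s \<le> t * r t - H t"
  proof (cases "s = t")
    case False
    have sub: "x \<in> T" if "s \<le> x" "x \<le> t" for x
      using that st T(1) by (meson mem_is_interval_1_I)
    obtain z where z: "s < z" "z < t" "H t - H s = (t - s) * r z"
      using MVT2[of s t H r] False st H sub by force
    have "r z \<le> r t" using z st sub by (intro mono_onD[OF r]) auto
    then have "(t - s) * r z \<le> (t - s) * r t" using st by (intro mult_left_mono) auto
    moreover have "s * r s \<le> s * r t"
      using st T(2) by (intro mult_left_mono mono_onD[OF r]) auto
    ultimately show ?thesis using z by (simp add: algebra_simps)
  qed simp
qed

lemma antimono_on_excess: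
  fixes H r :: "real \<Rightarrow> real"
  assumes T: "is_interval T" "T \<subseteq> {0..}"
    and H: "\<And>x. x \<in> T \<Longrightarrow> (H has_real_derivative r x) (at x)" and r: "antimono_on T r"
  shows "antimono_on T (\<lambda>x. x * r x - H x)"
proof -
  have "mono_on T (\<lambda>x. x * (- r x) - (- H x))"
    by (rule mono_on_excess) (use assms in \<open>auto intro!: DERIV_minus simp: monotone_on_def\<close>)
  then show ?thesis by (fastforce simp: monotone_on_def)
qed

text \<open>The turning point \<open>c\<close> from the definition may differ from the given maximum
  point \<open>t\<close>. Since \<open>r\<close> is constant between them, \<open>t\<close> is a
  turning point too.\<close>

lemma upside_down_bathtub_excess:
  fixes H r :: "real \<Rightarrow> real"
  assumes S: "is_interval S" "S \<subseteq> {0..}"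
    and H: "\<And>x. x \<in> S \<Longrightarrow> (H has_real_derivative r x) (at x)"
    and "upside_down_bathtub S r" and t: "t \<in> S" "\<And>x. x \<in> S \<Longrightarrow> r x \<le> r t"
  shows "mono_on (S \<inter> {..t}) (\<lambda>x. x * r x - H x)"
    and "antimono_on (S \<inter> {t..}) (\<lambda>x. x * r x - H x)"
proof -
  obtain c where c: "c \<in> S" and up: "mono_on (S \<inter> {..<c}) r" and down: "antimono_on (S \<inter> {c<..}) r"
    using assms(4) interior_subset by (auto simp: upside_down_bathtub_def)
  have sub: "x \<in> S" if "a \<in> S" "b \<in> S" "a \<le> x" "x \<le> b" for a b x
    using that S(1) by (meson mem_is_interval_1_I)
  \<comment> \<open>The definition leaves \<open>r c\<close> unconstrained; it is the maximum because \<open>r\<close> is a derivative.\<close>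
  have up': "r x \<le> r y" if "x \<in> S" "y \<in> S" "x \<le> y" "y \<le> c" for x y
  proof (cases "y = c")
    case True
    show ?thesis
    proof (cases "x = c")
      case False
      have "r x \<le> r c"
        by (rule derivative_ge_of_left[of x c H])
          (use that c False in \<open>auto intro!: H sub[of x c] mono_onD[OF up]\<close>)
      then show ?thesis using True by simp
    qed (use True in simp)
  qed (use that in \<open>auto intro!: mono_onD[OF up]\<close>)
  have down': "r y \<le> r x" if "x \<in> S" "y \<in> S" "x \<le> y" "c \<le> x" for x y
  proof (cases "x = c")
    case True
    show ?thesis
    proof (cases "y = c")
      case False
      have "r y \<le> r c"
        by (rule derivative_ge_of_right[of c y H])
          (use that c False in \<open>auto intro!: H sub[of c y] monotone_onD[OF down]\<close>)
      then show ?thesis using True by simp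
    qed (use True in simp)
  qed (use that in \<open>auto intro!: monotone_onD[OF down]\<close>)
  \<comment> \<open>Going from \<open>t\<close> towards \<open>c\<close>, \<open>r\<close> cannot
    decrease, and it cannot exceed its maximum \<open>r t\<close>.\<close>
  have mid: "r x = r t" if "x \<in> S" "min c t \<le> x" "x \<le> max c t" for x
    using up'[of t x] down'[of x t] t that by (cases "t \<le> c") (auto intro!: antisym)
  have "mono_on (S \<inter> {..t}) r"
  proof (rule mono_onI)
    fix x y assume xy: "x \<in> S \<inter> {..t}" "y \<in> S \<inter> {..t}" "x \<le> y"
    show "r x \<le> r y"
      using xy up'[of x y] mid[of y] t(2)[of x] by (cases "y \<le> c") auto
  qed
  then show "mono_on (S \<inter> {..t}) (\<lambda>x. x * r x - H x)"
    using S by (intro mono_on_excess is_interval_Int is_interval_ic H) auto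
  have "antimono_on (S \<inter> {t..}) r"
  proof (rule monotone_onI)
    fix x y assume xy: "x \<in> S \<inter> {t..}" "y \<in> S \<inter> {t..}" "x \<le> y"
    show "r y \<le> r x"
      using xy down'[of x y] mid[of x] t(2)[of y] by (cases "c \<le> x") auto
  qed
  then show "antimono_on (S \<inter> {t..}) (\<lambda>x. x * r x - H x)"
    using S by (intro antimono_on_excess is_interval_Int is_interval_ci H) auto
qed

section \<open>Distribution function, density and quantile function\<close>

lemma is_interval_einterval: "is_interval (einterval a b)"
  unfolding is_interval_1 Ball_def einterval_iff
  by (meson ereal_less_eq(3) less_le_trans le_less_trans)

text \<open>The setting is stated for the law \<open>N\<close> on the line. Positivity of
  \<open>f\<close> at the quantiles is explicit because \<open>1 / 0 = 0\<close> in HOL would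
  otherwise let the derivative assumption admit a vanishing density.\<close>

locale lifetime = real_distribution N for N :: "real measure" +
  fixes f F Q :: "real \<Rightarrow> real"
  assumes f_nonneg: "0 \<le> f x"
    and f_measurable[measurable]: "f \<in> borel_measurable borel"
    and N_density: "N = density lborel (\<lambda>x. ennreal (f x))"
    and N_nonneg: "AE x in N. 0 \<le> x"
    and F_cdf: "F = cdf N"
    and Q_quantile: "Q = quantile F"
    and density_quantile_pos: "p \<in> {0<..<1} \<Longrightarrow> 0 < f (Q p)"
    and quantile_DERIV: "p \<in> {0<..<1} \<Longrightarrow> (Q has_real_derivative 1 / f (Q p)) (at p)"
begin

lemma F_mono: "x \<le> y \<Longrightarrow> F x \<le> F y"
  by (simp add: F_cdf cdf_nondecreasing)

lemma F_nonneg: "0 \<le> F x" and F_le_1: "F x \<le> 1"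
  by (simp_all add: F_cdf cdf_nonneg cdf_bounded_prob)

lemma isCont_F: "isCont F x"
proof -
  have "emeasure N {x} = (\<integral>\<^sup>+y. ennreal (f y) * indicator {x} y \<partial>lborel)"
    by (simp add: N_density emeasure_density)
  also have "\<dots> = (\<integral>\<^sup>+(y::real). 0 \<partial>lborel)"
  proof (rule nn_integral_cong_AE)
    show "AE y in lborel. ennreal (f y) * indicator {x} y = 0"
      using AE_lborel_singleton[of x] by eventually_elim simp
  qed
  finally show ?thesis by (simp add: F_cdf isCont_cdf measure_def)
qed

lemma continuous_on_F: "continuous_on A F"
  by (simp add: continuous_at_imp_continuous_on isCont_F)

lemma F_nonpos: assumes "x \<le> 0" shows "F x = 0"
proof -
  have "F x \<le> F 0" using assms by (rule F_mono)
  also have "F 0 = measure N {..<0} + measure N {0}"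
    unfolding F_cdf cdf_def by (subst finite_measure_Union[symmetric])
      (auto intro!: arg_cong[where f = "measure N"])
  also have "measure N {0} = 0" using isCont_F by (simp add: F_cdf isCont_cdf)
  also have "measure N {..<0} = 0"
    using N_nonneg by (intro measure_eq_0_null_sets AE_iff_null_sets[THEN iffD2]) auto
  finally show ?thesis using F_nonneg[of x] by simp
qed

text \<open>The set \<open>{x. p \<le> F x}\<close> is nonempty, bounded below by \<open>0\<close>,
  and closed because \<open>F\<close> is continuous, so its infimum is attained.\<close>

lemma quantile_le_iff: assumes p: "p \<in> {0<..<1}" shows "Q p \<le> x \<longleftrightarrow> p \<le> F x"
proof -
  have bdd: "bdd_below {x. p \<le> F x}"
  proof (rule bdd_belowI)
    fix x assume "x \<in> {x. p \<le> F x}"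
    then show "0 \<le> x" using p F_nonpos[of x] by (cases "x \<le> 0") auto
  qed
  have "\<forall>\<^sub>F x in at_top. p < F x"
    unfolding F_cdf by (rule order_tendstoD(1)[OF cdf_lim_at_top_prob]) (use p in auto)
  then obtain y where "p < F y" by (auto simp: eventually_at_top_linorder)
  then have ne: "{x. p \<le> F x} \<noteq> {}" by (auto intro: less_imp_le)
  have "closed {x. p \<le> F x}"
    by (intro closed_Collect_le continuous_on_F continuous_on_const)
  then have "p \<le> F (Q p)"
    using closed_contains_Inf[OF ne bdd] by (simp add: Q_quantile quantile_def)
  then show ?thesis
    using F_mono[of "Q p" x] cInf_lower[OF _ bdd, of x] by (auto simp: Q_quantile quantile_def)
qed

lemma F_quantile: assumes p: "p \<in> {0<..<1}" shows "F (Q p) = p"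
proof (rule antisym)
  show "p \<le> F (Q p)" using quantile_le_iff[OF p] by blast
  have "(F \<longlongrightarrow> F (Q p)) (at_left (Q p))"
    using isCont_F[of "Q p"] by (auto simp: isCont_def intro: tendsto_within_subset)
  then show "F (Q p) \<le> p"
  proof (rule tendsto_upperbound)
    show "\<forall>\<^sub>F x in at_left (Q p). F x \<le> p"
      using quantile_le_iff[OF p] by (auto simp: eventually_at_left_field intro!: exI[of _ "Q p - 1"])
        (meson less_imp_le not_le)
  qed auto
qed

text \<open>A flat piece of \<open>F\<close> at a level in \<open>(0, 1)\<close> would be a jump of
  \<open>Q\<close>, which is excluded by differentiability of \<open>Q\<close>.\<close>

lemma quantile_F: assumes x: "0 < F x" "F x < 1" shows "Q (F x) = x"
proof (rule antisym)
  show "Q (F x) \<le> x" using quantile_le_iff[of "F x" x] x by auto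
  have "isCont Q (F x)" using quantile_DERIV[of "F x"] x by (auto intro: DERIV_isCont)
  then have "(Q \<longlongrightarrow> Q (F x)) (at_right (F x))"
    by (auto simp: isCont_def intro: tendsto_within_subset)
  then show "x \<le> Q (F x)"
  proof (rule tendsto_lowerbound)
    have "x \<le> Q p" if "F x < p" "p < 1" for p
      using quantile_le_iff[of p x] that x by auto
    then show "\<forall>\<^sub>F p in at_right (F x). x \<le> Q p"
      using x by (auto intro!: eventually_at_rightI[of "F x" 1])
  qed auto
qed

text \<open>The inverse function rule for \<open>Q\<close> makes \<open>f\<close> the derivative of
  \<open>F\<close> at every such point, where a density alone would give this only almost
  everywhere.\<close>

lemma F_DERIV: assumes x: "0 < F x" "F x < 1" shows "(F has_real_derivative f x) (at x)"
proof -
  have "open {y. 0 < F y \<and> F y < 1}"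
    by (intro open_Collect_conj open_Collect_less continuous_on_F continuous_on_const)
  then obtain e where e: "e > 0" "ball x e \<subseteq> {y. 0 < F y \<and> F y < 1}"
    using x by (auto simp: open_contains_ball)
  have "(F has_real_derivative inverse (1 / f x)) (at x)"
  proof (rule DERIV_inverse_function[where a = "x - e" and b = "x + e"])
    show "(Q has_real_derivative 1 / f x) (at (F x))"
      using quantile_DERIV[of "F x"] x by (simp add: quantile_F)
    show "1 / f x \<noteq> 0" using density_quantile_pos[of "F x"] x by (simp add: quantile_F)
    show "Q (F y) = y" if "x - e < y" "y < x + e" for y
    proof (rule quantile_F)
      have "y \<in> ball x e" using that by (simp add: dist_real_def abs_less_iff)
      then show "0 < F y" "F y < 1" using e by auto
    qed
  qed (use e isCont_F in auto)
  then show ?thesis by simp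
qed

section \<open>The cumulative hazard as an integral of the hazard rate\<close>

definition H :: "real \<Rightarrow> real" where "H x = - ln (1 - F x)"

lemma H_nonneg: "F x < 1 \<Longrightarrow> 0 \<le> H x"
  using F_nonneg[of x] by (simp add: H_def)

lemma H_pos: "0 < F x \<Longrightarrow> F x < 1 \<Longrightarrow> 0 < H x"
  by (simp add: H_def)

lemma H_quantile: "p \<in> {0<..<1} \<Longrightarrow> H (Q p) = - ln (1 - p)"
  by (simp add: H_def F_quantile)

lemma isCont_H: "F x < 1 \<Longrightarrow> isCont H x"
  unfolding H_def[abs_def] by (intro isCont_minus isCont_ln' isCont_diff isCont_F continuous_const) auto

lemma H_DERIV:
  assumes x: "0 < F x" "F x < 1" shows "(H has_real_derivative hazard_rate f F x) (at x)"
proof -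
  have "((\<lambda>x. 1 - F x) has_real_derivative - f x) (at x)"
    using DERIV_diff[OF DERIV_const F_DERIV[OF x]] by simp
  from DERIV_minus[OF DERIV_chain2[OF DERIV_ln_divide this]]
  show ?thesis using x by (simp add: H_def[abs_def] hazard_rate_def)
qed

lemma hazard_nonneg: "0 \<le> hazard_rate f F x"
  using f_nonneg F_le_1[of x] by (simp add: hazard_rate_def)

text \<open>The largest zero of \<open>F\<close> serves as the left end of the support. It exists
  because the zero set is closed and bounded above by \<open>t\<close>.\<close>

lemma last_zero:
  assumes "0 < F t" obtains a where "0 \<le> a" "a < t" "F a = 0" "\<And>x. a < x \<Longrightarrow> 0 < F x"
proof
  define a where "a = Sup {x. F x \<le> 0}"
  have bdd: "bdd_above {x. F x \<le> 0}"
  proof (rule bdd_aboveI)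
    fix x assume "x \<in> {x. F x \<le> 0}"
    then show "x \<le> t" using assms F_mono[of t x] by (cases "x \<le> t") auto
  qed
  have 0: "0 \<in> {x. F x \<le> 0}" by (simp add: F_nonpos)
  have "closed {x. F x \<le> 0}"
    by (intro closed_Collect_le continuous_on_F continuous_on_const)
  then have "a \<in> {x. F x \<le> 0}"
    unfolding a_def using 0 bdd by (intro closed_contains_Sup) auto
  then show Fa: "F a = 0" using F_nonneg[of a] by simp
  show "0 \<le> a" unfolding a_def by (rule cSup_upper[OF 0 bdd])
  show pos: "0 < F x" if "a < x" for x
    using cSup_upper[OF _ bdd, of x] that unfolding a_def by force
  show "a < t" using Fa assms F_mono[of t a] by (cases "a < t") auto
qed

lemma AE_density_0: assumes "F a = 0" shows "AE x in lborel. x \<le> a \<longrightarrow> f x = 0"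
proof -
  have "emeasure N {..a} = 0" using assms by (simp add: F_cdf cdf_def emeasure_eq_measure)
  then have "(\<integral>\<^sup>+x. ennreal (f x) * indicator {..a} x \<partial>lborel) = 0"
    by (simp add: N_density emeasure_density)
  then have "AE x in lborel. ennreal (f x) * indicator {..a} x = 0"
    by (subst (asm) nn_integral_0_iff_AE) auto
  then show ?thesis
    by eventually_elim
      (use f_nonneg in \<open>auto simp: indicator_def ennreal_eq_0_iff intro: antisym split: if_splits\<close>)
qed

lemma F_measurable[measurable]: "F \<in> borel_measurable borel"
  by (intro borel_measurable_continuous_onI continuous_on_F)

lemma hazard_measurable[measurable]: "hazard_rate f F \<in> borel_measurable borel"
  unfolding hazard_rate_def[abs_def] by measurable

text \<open>With \<open>a\<close> the last zero of \<open>F\<close>, the fundamental theorem applies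
  on \<open>[a, t]\<close>, and the hazard rate vanishes almost everywhere up to \<open>a\<close>.
  Nonnegativity carries the gauge integral over to the Lebesgue integral.\<close>

lemma integral_hazard:
  assumes t: "0 < t" "F t < 1" shows "(LBINT x=0..t. hazard_rate f F x) = H t"
proof (cases "0 < F t")
  case False
  then have Ft: "F t = 0" using F_nonneg[of t] by simp
  have "(LBINT x=0..t. hazard_rate f F x) = (LBINT x=0..t. 0)"
  proof (rule interval_lebesgue_integral_cong_AE)
    show "AE x\<in>einterval 0 (ereal t) in lborel. hazard_rate f F x = 0"
      using AE_density_0[OF Ft] by eventually_elim (auto simp: einterval_iff hazard_rate_def)
  qed (use t in auto)
  then show ?thesis using Ft by (simp add: H_def)
next
  case True
  then obtain a where a: "0 \<le> a" "a < t" "F a = 0" "\<And>x. a < x \<Longrightarrow> 0 < F x"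
    by (rule last_zero) blast
  have lt1: "F x < 1" if "x \<le> t" for x using F_mono[OF that] t by simp
  have "(hazard_rate f F has_integral (H t - H a)) {a..t}"
  \<comment> \<open>\<open>H\<close> may fail to be differentiable at \<open>a\<close>; there only
    its continuity is used.\<close>
  proof (rule fundamental_theorem_of_calculus_interior)
    show "continuous_on {a..t} H"
      using lt1 by (intro continuous_at_imp_continuous_on ballI isCont_H) auto
    show "(H has_vector_derivative hazard_rate f F x) (at x)" if "x \<in> {a<..<t}" for x
      unfolding has_real_derivative_iff_has_vector_derivative[symmetric]
      using that a lt1 by (intro H_DERIV) auto
  qed (use a in auto)
  then have "(\<integral>\<^sup>+x. ennreal (hazard_rate f F x) * indicator {a..t} x \<partial>lborel) = ennreal (H t)"
    using a by (subst nn_integral_has_integral_lebesgue') (auto simp: hazard_nonneg H_def)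
  then have *: "(\<integral>\<^sup>+x. ennreal (indicator {a..t} x * hazard_rate f F x) \<partial>lborel) = ennreal (H t)"
    by (subst (asm) nn_integral_cong[of _ _ "\<lambda>x. ennreal (indicator {a..t} x * hazard_rate f F x)"])
       (auto simp: indicator_def)
  have "(LBINT x=0..t. hazard_rate f F x)
      = (\<integral>x. indicator (einterval 0 (ereal t)) x * hazard_rate f F x \<partial>lborel)"
    using t by (simp add: interval_lebesgue_integral_def set_lebesgue_integral_def)
  also have "\<dots> = (\<integral>x. indicator {a..t} x * hazard_rate f F x \<partial>lborel)"
  \<comment> \<open>The two sets differ only at \<open>t\<close> and at points up to
    \<open>a\<close>, where the density is zero almost everywhere.\<close>
  proof (rule integral_cong_AE)
    show "AE x in lborel. indicator (einterval 0 (ereal t)) x * hazard_rate f F x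
        = indicator {a..t} x * hazard_rate f F x"
      using AE_density_0[OF a(3)] AE_lborel_singleton[of t]
      by eventually_elim (use a in \<open>auto simp: einterval_iff hazard_rate_def indicator_def\<close>)
  qed auto
  also have "\<dots> = H t"
    using * lt1[of t] by (subst integral_eq_nn_integral) (auto simp: hazard_nonneg H_nonneg)
  finally show ?thesis .
qed

section \<open>IFRA and DFRA as sign conditions on the excess\<close>

lemma average_DERIV:
  assumes x: "0 < x" "0 < F x" "F x < 1"
  shows "((\<lambda>t. H t / t) has_real_derivative (x * hazard_rate f F x - H x) / x\<^sup>2) (at x)"
  using DERIV_divide[OF H_DERIV[OF x(2,3)] DERIV_ident] x
  by (simp add: power2_eq_square algebra_simps)

lemma pos_of_F_pos: "0 < F x \<Longrightarrow> 0 < x"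
  using F_nonpos[of x] by force

text \<open>\<open>Q\<close> maps \<open>(0, 1)\<close> onto
  \<open>{x. 0 < F x \<and> F x < 1}\<close>, as \<open>F\<close> and \<open>Q\<close> invert each
  other there.\<close>

lemma all_quantile: "(\<forall>p\<in>{0<..<1}. P (Q p)) \<longleftrightarrow> (\<forall>x. 0 < F x \<longrightarrow> F x < 1 \<longrightarrow> P x)"
proof safe
  fix x assume "\<forall>p\<in>{0<..<1}. P (Q p)" "0 < F x" "F x < 1"
  then show "P x" using quantile_F[of x] by (metis greaterThanLessThan_iff)
qed (simp add: F_quantile)

lemma average_continuous: "0 < s \<Longrightarrow> F t < 1 \<Longrightarrow> continuous_on {s..t} (\<lambda>x. H x / x)"
proof (intro continuous_at_imp_continuous_on ballI)
  fix x assume "0 < s" "F t < 1" "x \<in> {s..t}"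
  then have "F x < 1" "x \<noteq> 0" using F_mono[of x t] by auto
  then show "isCont (\<lambda>x. H x / x) x"
    by (intro isCont_divide isCont_H continuous_ident) auto
qed

lemma interior_average_domain:
  assumes x: "0 < F x" "F x < 1" shows "x \<in> interior {t. 0 < t \<and> F t < 1}"
proof (rule interiorI)
  show "open {t. 0 < F t \<and> F t < 1}"
    by (intro open_Collect_conj open_Collect_less continuous_on_F continuous_on_const)
qed (use x in \<open>auto intro: pos_of_F_pos\<close>)

lemma IFRA_iff_average: "IFRA f F \<longleftrightarrow> mono_on {t. 0 < t \<and> F t < 1} (\<lambda>t. H t / t)"
  unfolding IFRA_def monotone_on_def by (auto simp: integral_hazard)

lemma DFRA_iff_average: "DFRA f F \<longleftrightarrow> antimono_on {t. 0 < t \<and> F t < 1} (\<lambda>t. H t / t)"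
  unfolding DFRA_def monotone_on_def by (auto simp: integral_hazard)

text \<open>Where \<open>F\<close> is positive, the excess gives the sign of the derivative of
  \<open>H t / t\<close>. Where \<open>F\<close> vanishes the average is \<open>0\<close>, below
  every later value, so a gap before the support does no harm.\<close>

lemma IFRA_iff: "IFRA f F \<longleftrightarrow> (\<forall>p\<in>{0<..<1}. 0 \<le> Q p * hazard_rate f F (Q p) - H (Q p))"
  unfolding all_quantile[where P = "\<lambda>x. 0 \<le> x * hazard_rate f F x - H x"] IFRA_iff_average
proof (intro iffI allI impI)
  fix x assume m: "mono_on {t. 0 < t \<and> F t < 1} (\<lambda>t. H t / t)" and x: "0 < F x" "F x < 1"
  have "0 \<le> (x * hazard_rate f F x - H x) / x\<^sup>2"
    by (rule mono_on_imp_deriv_nonneg[OF m average_DERIV[OF pos_of_F_pos[OF x(1)] x]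
          interior_average_domain[OF x]])
  then show "0 \<le> x * hazard_rate f F x - H x"
    using pos_of_F_pos[OF x(1)] by (simp add: zero_le_divide_iff)
next
  assume *: "\<forall>x. 0 < F x \<longrightarrow> F x < 1 \<longrightarrow> 0 \<le> x * hazard_rate f F x - H x"
  show "mono_on {t. 0 < t \<and> F t < 1} (\<lambda>t. H t / t)"
  proof (rule mono_onI)
    fix s t assume st: "s \<in> {t. 0 < t \<and> F t < 1}" "t \<in> {t. 0 < t \<and> F t < 1}" "s \<le> t"
    show "H s / s \<le> H t / t"
    proof (cases "0 < F s")
      case False
      then have "F s = 0" using F_nonneg[of s] by simp
      then have "H s / s = 0" by (simp add: H_def)
      also have "0 \<le> H t / t" using st by (intro divide_nonneg_pos H_nonneg) auto
      finally show ?thesis .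
    next
      case True
      show ?thesis
      proof (rule DERIV_nonneg_imp_increasing_open[where f = "\<lambda>x. H x / x"])
        fix x assume "s < x" "x < t"
        then have x: "0 < x" "0 < F x" "F x < 1"
          using st True F_mono[of s x] F_mono[of x t] by auto
        show "\<exists>y. ((\<lambda>x. H x / x) has_real_derivative y) (at x) \<and> 0 \<le> y"
          using average_DERIV[OF x] * x by (intro exI conjI) auto
      qed (use st average_continuous in auto)
    qed
  qed
qed

text \<open>Here a gap before the support would break monotonicity, since the average would rise
  from \<open>0\<close>. The sign condition beyond the gap already excludes it.\<close>

lemma DFRA_iff: "DFRA f F \<longleftrightarrow> (\<forall>p\<in>{0<..<1}. Q p * hazard_rate f F (Q p) - H (Q p) \<le> 0)"
  unfolding all_quantile[where P = "\<lambda>x. x * hazard_rate f F x - H x \<le> 0"] DFRA_iff_average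
proof (intro iffI allI impI)
  fix x assume "antimono_on {t. 0 < t \<and> F t < 1} (\<lambda>t. H t / t)" and x: "0 < F x" "F x < 1"
  then have m: "mono_on {t. 0 < t \<and> F t < 1} (\<lambda>t. - (H t / t))"
    by (auto simp: monotone_on_def)
  have "0 \<le> - ((x * hazard_rate f F x - H x) / x\<^sup>2)"
    by (rule mono_on_imp_deriv_nonneg[OF m DERIV_minus[OF average_DERIV[OF pos_of_F_pos[OF x(1)] x]]
          interior_average_domain[OF x]])
  then show "x * hazard_rate f F x - H x \<le> 0"
    using pos_of_F_pos[OF x(1)] by (simp add: divide_le_0_iff)
next
  assume *: "\<forall>x. 0 < F x \<longrightarrow> F x < 1 \<longrightarrow> x * hazard_rate f F x - H x \<le> 0"
  \<comment> \<open>Positivity of \<open>F\<close> is asked only to the right of \<open>s\<close>,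
    so that \<open>s\<close> may be the last zero of \<open>F\<close>.\<close>
  have dec: "H t / t \<le> H s / s" if "0 < s" "s \<le> t" "F t < 1" "\<And>x. s < x \<Longrightarrow> 0 < F x" for s t
  proof (rule DERIV_nonpos_imp_decreasing_open[where f = "\<lambda>x. H x / x"])
    fix x assume "s < x" "x < t"
    then have x: "0 < x" "0 < F x" "F x < 1"
      using that F_mono[of x t] by auto
    show "\<exists>y. ((\<lambda>x. H x / x) has_real_derivative y) (at x) \<and> y \<le> 0"
      using average_DERIV[OF x] * x by (intro exI conjI) (auto simp: divide_le_0_iff)
  qed (use that average_continuous in auto)
  show "antimono_on {t. 0 < t \<and> F t < 1} (\<lambda>t. H t / t)"
  proof (rule monotone_onI)
    fix s t assume st: "s \<in> {t. 0 < t \<and> F t < 1}" "t \<in> {t. 0 < t \<and> F t < 1}" "s \<le> t"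
    show "H t / t \<le> H s / s"
    proof (cases "0 < F s")
      case True
      then show ?thesis using st F_mono[of s] by (intro dec) (auto intro: less_le_trans)
    next
      case False
      then have Fs: "F s = 0" using F_nonneg[of s] by simp
      \<comment> \<open>The average hazard rate would start from \<open>0\<close> at the left end \<open>a\<close> of the support.\<close>
      have "\<not> 0 < F t"
      proof
        assume Ft: "0 < F t"
        then obtain a where a: "a < t" "F a = 0" "\<And>x. a < x \<Longrightarrow> 0 < F x"
          by (rule last_zero) blast
        have "s \<le> a" using a(3)[of s] Fs by fastforce
        then have "H t / t \<le> H a / a" using st a by (intro dec) auto
        moreover have "0 < H t / t" using st Ft by (intro divide_pos_pos H_pos) auto
        ultimately show False using a by (simp add: H_def)
      qed
      then have "F t = 0" using F_nonneg[of t] by simp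
      then show ?thesis using Fs by (simp add: H_def)
    qed
  qed
qed

section \<open>The open support interval\<close>

text \<open>Mass on both sides of an interior point puts \<open>F\<close> strictly between
  \<open>0\<close> and \<open>1\<close>. Conversely, strict increase of \<open>F\<close> places the
  open set \<open>?S\<close> in the support, hence in the interior of the closure of an open
  interval, which is the interval.\<close>

lemma strict_support:
  assumes "interval_support N l u" shows "einterval l u = {x. 0 < F x \<and> F x < 1}"
proof
  let ?S = "{x. 0 < F x \<and> F x < 1}"
  have supp: "msupport N = closure (einterval l u)"
    using assms by (simp add: interval_support_def)
  have conv: "convex (einterval l u)"
    by (simp add: is_interval_convex_1[symmetric] is_interval_einterval)
  show "einterval l u \<subseteq> ?S"
  proof
    fix x assume x: "x \<in> einterval l u"
    then obtain e where e: "e > 0" "ball x e \<subseteq> einterval l u"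
      using open_einterval[of l u] by (auto simp: open_contains_ball)
    have pos: "0 < emeasure N A" if "open A" "y \<in> A" "y \<in> ball x e" for A y
    proof -
      have "y \<in> msupport N" unfolding supp using that e closure_subset by blast
      then show ?thesis using that by (auto simp: msupport_def)
    qed
    have "0 < emeasure N {..<x}"
      using e by (intro pos[of _ "x - e / 2"]) (auto simp: dist_real_def)
    also have "\<dots> \<le> emeasure N {..x}" by (intro emeasure_mono) auto
    finally have 1: "0 < F x" by (simp add: F_cdf cdf_def emeasure_eq_measure)
    have "0 < emeasure N {x<..}"
      using e by (intro pos[of _ "x + e / 2"]) (auto simp: dist_real_def)
    then have "0 < measure N (space N - {..x})"
      by (simp add: emeasure_eq_measure Compl_eq_Diff_UNIV[symmetric] Compl_atMost)
    then have "F x < 1" by (subst (asm) prob_compl) (auto simp: F_cdf cdf_def)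
    then show "x \<in> ?S" using 1 by auto
  qed
  have "?S \<subseteq> msupport N"
    unfolding msupport_def
  proof safe
    fix x A assume x: "0 < F x" "F x < 1" and A: "open A" "x \<in> A"
    then obtain e where e: "e > 0" "cball x e \<subseteq> A" by (auto simp: open_contains_cball)
    \<comment> \<open>Equality would give \<open>x = x + e\<close> on applying
      \<open>Q\<close>.\<close>
    have "F x < F (x + e)"
      using quantile_F[OF x] quantile_F[of "x + e"] e F_mono[of x "x + e"] x
      by (cases "F x = F (x + e)") auto
    then have "0 < measure N {x<..x + e}"
      using cdf_diff_eq[of x "x + e"] e by (simp add: F_cdf)
    also have "\<dots> \<le> measure N A"
      using A e by (intro finite_measure_mono) (auto simp: dist_real_def subset_iff)
    finally show "0 < emeasure N A" by (simp add: emeasure_eq_measure)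
  qed
  moreover have "open ?S"
    by (intro open_Collect_conj open_Collect_less continuous_on_F continuous_on_const)
  ultimately have "?S \<subseteq> interior (closure (einterval l u))"
    unfolding supp[symmetric] by (rule interior_maximal)
  then show "?S \<subseteq> einterval l u"
    by (simp add: convex_interior_closure[OF conv] interior_open)
qed

section \<open>The ageing criteria on the quantile scale\<close>

text \<open>Composition with the increasing \<open>Q\<close> carries the two branches over to
  \<open>(0, 1)\<close>. The pair \<open>k\<close>, \<open>h\<close> is left general to cover both
  \<open>r\<close>, \<open>H\<close> and their negatives.\<close>

lemma upside_down_bathtub_quantile:
  fixes k h :: "real \<Rightarrow> real"
  assumes S: "S = {x. 0 < F x \<and> F x < 1}" and p: "p \<in> {0<..<1}"
    and h: "\<And>x. x \<in> S \<Longrightarrow> (h has_real_derivative k x) (at x)"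
    and k: "upside_down_bathtub S k" "\<And>x. x \<in> S \<Longrightarrow> k x \<le> k (Q p)"
  shows "mono_on {0<..p} (\<lambda>q. Q q * k (Q q) - h (Q q))"
    and "antimono_on {p..<1} (\<lambda>q. Q q * k (Q q) - h (Q q))"
proof -
  have QS: "Q q \<in> S" if "q \<in> {0<..<1}" for q
    using that by (simp add: S F_quantile)
  have Q_mono: "Q q \<le> Q q'" if "q \<in> {0<..<1}" "q' \<in> {0<..<1}" "q \<le> q'" for q q'
    using that by (simp add: quantile_le_iff F_quantile)
  have "is_interval S"
    unfolding is_interval_1 S using F_mono by (auto intro: less_le_trans le_less_trans)
  moreover have "S \<subseteq> {0..}" using pos_of_F_pos by (auto simp: S less_imp_le)
  ultimately have *: "mono_on (S \<inter> {..Q p}) (\<lambda>x. x * k x - h x)"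
    "antimono_on (S \<inter> {Q p..}) (\<lambda>x. x * k x - h x)"
    using upside_down_bathtub_excess[of S h k "Q p"] h k QS[OF p] by blast+
  show "mono_on {0<..p} (\<lambda>q. Q q * k (Q q) - h (Q q))"
  proof (rule mono_onI)
    fix q q' assume "q \<in> {0<..p}" "q' \<in> {0<..p}" "q \<le> q'"
    then show "Q q * k (Q q) - h (Q q) \<le> Q q' * k (Q q') - h (Q q')"
      using p by (intro mono_onD[OF *(1)]) (auto intro!: QS Q_mono)
  qed
  show "antimono_on {p..<1} (\<lambda>q. Q q * k (Q q) - h (Q q))"
  proof (rule monotone_onI)
    fix q q' assume "q \<in> {p..<1}" "q' \<in> {p..<1}" "q \<le> q'"
    then show "Q q' * k (Q q') - h (Q q') \<le> Q q * k (Q q) - h (Q q)"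
      using p by (intro monotone_onD[OF *(2)]) (auto intro!: QS Q_mono)
  qed
qed

lemma upside_down_bathtub_ageing:
  assumes p: "p \<in> {0<..<1}" and S: "S = {x. 0 < F x \<and> F x < 1}" and r: "r = hazard_rate f F"
    and ubt: "upside_down_bathtub S r" "\<And>x. x \<in> S \<Longrightarrow> r x \<le> r (Q p)"
  shows "\<exists>L0 L1 :: ereal. ((\<lambda>q. ereal (Q q * r (Q q) + ln (1 - q))) \<longlongrightarrow> L0) (at_right 0) \<and>
      ((\<lambda>q. ereal (Q q * r (Q q) + ln (1 - q))) \<longlongrightarrow> L1) (at_left 1) \<and>
      (IFRA f F \<longleftrightarrow> 0 \<le> L0 \<and> 0 \<le> L1)"
    and "DFRA f F \<longleftrightarrow> Q p * r (Q p) + ln (1 - p) \<le> 0"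
proof -
  have "(H has_real_derivative r x) (at x)" if "x \<in> S" for x
    using that H_DERIV by (simp add: S r)
  note * = upside_down_bathtub_quantile[OF S p this ubt]
  have "mono_on {0<..p} (\<lambda>q. Q q * r (Q q) + ln (1 - q))"
    "antimono_on {p..<1} (\<lambda>q. Q q * r (Q q) + ln (1 - q))"
    using *[unfolded monotone_on_def] p by (auto simp: monotone_on_def H_quantile)
  from unimodal_sign[OF p this]
  show "\<exists>L0 L1 :: ereal. ((\<lambda>q. ereal (Q q * r (Q q) + ln (1 - q))) \<longlongrightarrow> L0) (at_right 0) \<and>
      ((\<lambda>q. ereal (Q q * r (Q q) + ln (1 - q))) \<longlongrightarrow> L1) (at_left 1) \<and>
      (IFRA f F \<longleftrightarrow> 0 \<le> L0 \<and> 0 \<le> L1)"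
    and "DFRA f F \<longleftrightarrow> Q p * r (Q p) + ln (1 - p) \<le> 0"
    by (simp_all add: IFRA_iff DFRA_iff H_quantile r)
qed

text \<open>The negated excess is unimodal, so IFRA and DFRA exchange roles.\<close>

lemma bathtub_ageing:
  assumes p: "p \<in> {0<..<1}" and S: "S = {x. 0 < F x \<and> F x < 1}" and r: "r = hazard_rate f F"
    and bt: "bathtub S r" "\<And>x. x \<in> S \<Longrightarrow> r (Q p) \<le> r x"
  shows "\<exists>L0 L1 :: ereal. ((\<lambda>q. ereal (Q q * r (Q q) + ln (1 - q))) \<longlongrightarrow> L0) (at_right 0) \<and>
      ((\<lambda>q. ereal (Q q * r (Q q) + ln (1 - q))) \<longlongrightarrow> L1) (at_left 1) \<and>
      (DFRA f F \<longleftrightarrow> L0 \<le> 0 \<and> L1 \<le> 0)"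
    and "IFRA f F \<longleftrightarrow> 0 \<le> Q p * r (Q p) + ln (1 - p)"
proof -
  let ?\<phi> = "\<lambda>q. - (Q q * r (Q q) + ln (1 - q))"
  have D: "((\<lambda>x. - H x) has_real_derivative - r x) (at x)" if "x \<in> S" for x
    using that H_DERIV by (auto simp: S r intro: DERIV_minus)
  have "upside_down_bathtub S (\<lambda>x. - r x)"
    using bt(1) by (simp add: bathtub_def upside_down_bathtub_def monotone_on_def)
  from upside_down_bathtub_quantile[OF S p D this] bt(2)
  have *: "mono_on {0<..p} (\<lambda>q. Q q * - r (Q q) - - H (Q q))"
    "antimono_on {p..<1} (\<lambda>q. Q q * - r (Q q) - - H (Q q))" by auto
  have "mono_on {0<..p} ?\<phi>" "antimono_on {p..<1} ?\<phi>"
    using *[unfolded monotone_on_def] p by (auto simp: monotone_on_def H_quantile algebra_simps)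
  note sign = unimodal_sign[OF p this]
  have pos: "(\<forall>q\<in>{0<..<1}. 0 \<le> ?\<phi> q) \<longleftrightarrow> DFRA f F"
    unfolding DFRA_iff by (intro ball_cong refl) (auto simp: H_quantile r)
  obtain L0 L1 :: ereal where L: "((\<lambda>q. ereal (?\<phi> q)) \<longlongrightarrow> L0) (at_right 0)"
    "((\<lambda>q. ereal (?\<phi> q)) \<longlongrightarrow> L1) (at_left 1)" "DFRA f F \<longleftrightarrow> 0 \<le> L0 \<and> 0 \<le> L1"
    using sign(1)[unfolded pos] by blast
  \<comment> \<open>Negation is continuous on the extended reals, so infinite limits are
    covered.\<close>
  have "((\<lambda>q. ereal (Q q * r (Q q) + ln (1 - q))) \<longlongrightarrow> - L0) (at_right 0)"
    "((\<lambda>q. ereal (Q q * r (Q q) + ln (1 - q))) \<longlongrightarrow> - L1) (at_left 1)"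
    using tendsto_uminus_ereal[OF L(1)] tendsto_uminus_ereal[OF L(2)]
    by (simp_all add: algebra_simps)
  moreover have "DFRA f F \<longleftrightarrow> - L0 \<le> 0 \<and> - L1 \<le> 0"
    by (simp add: L(3))
  ultimately show "\<exists>L0 L1 :: ereal.
      ((\<lambda>q. ereal (Q q * r (Q q) + ln (1 - q))) \<longlongrightarrow> L0) (at_right 0) \<and>
      ((\<lambda>q. ereal (Q q * r (Q q) + ln (1 - q))) \<longlongrightarrow> L1) (at_left 1) \<and>
      (DFRA f F \<longleftrightarrow> L0 \<le> 0 \<and> L1 \<le> 0)"
    by blast
  have "(\<forall>q\<in>{0<..<1}. ?\<phi> q \<le> 0) \<longleftrightarrow> IFRA f F"
    unfolding IFRA_iff by (intro ball_cong refl) (auto simp: H_quantile r)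
  then show "IFRA f F \<longleftrightarrow> 0 \<le> Q p * r (Q p) + ln (1 - p)"
    using sign(2) by (simp only: neg_le_0_iff_le)
qed

end

text \<open>Existence of the limits is part of the claim; they are unique, so the existential
  quantifiers over \<open>L0\<close> and \<open>L1\<close> leave no freedom.\<close>

theorem corollary3p6:
  fixes M :: "'a measure" and X :: "'a \<Rightarrow> real" and f F Q r :: "real \<Rightarrow> real"
    and l u :: ereal and pstar :: real
  assumes "prob_space M"
    and "AE \<omega> in M. 0 \<le> X \<omega>"
    and "integrable M X"
    and "\<And>x. 0 \<le> f x"
    and "distributed M lborel X (\<lambda>x. ennreal (f x))"
    and "F = cdf (distr M borel X)"
    and "interval_support (distr M borel X) l u"
    and "Q = quantile F"
    and "\<And>p. p \<in> {0<..<1} \<Longrightarrow> 0 < f (Q p)"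
    and "\<And>p. p \<in> {0<..<1} \<Longrightarrow> (Q has_real_derivative 1 / f (Q p)) (at p)"
    and "r = hazard_rate f F"
    and "pstar \<in> {0<..<1}"
  shows
    "(upside_down_bathtub (einterval l u) r \<and> (\<forall>x\<in>einterval l u. r x \<le> r (Q pstar)) \<longrightarrow>
       (\<exists>L0 L1 :: ereal.
          ((\<lambda>p. ereal (Q p * r (Q p) + ln (1 - p))) \<longlongrightarrow> L0) (at_right 0) \<and>
          ((\<lambda>p. ereal (Q p * r (Q p) + ln (1 - p))) \<longlongrightarrow> L1) (at_left 1) \<and>
          (IFRA f F \<longleftrightarrow> 0 \<le> L0 \<and> 0 \<le> L1)) \<and>
       (DFRA f F \<longleftrightarrow> Q pstar * r (Q pstar) + ln (1 - pstar) \<le> 0))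
     \<and>
     (bathtub (einterval l u) r \<and> (\<forall>x\<in>einterval l u. r (Q pstar) \<le> r x) \<longrightarrow>
       (\<exists>L0 L1 :: ereal.
          ((\<lambda>p. ereal (Q p * r (Q p) + ln (1 - p))) \<longlongrightarrow> L0) (at_right 0) \<and>
          ((\<lambda>p. ereal (Q p * r (Q p) + ln (1 - p))) \<longlongrightarrow> L1) (at_left 1) \<and>
          (DFRA f F \<longleftrightarrow> L0 \<le> 0 \<and> L1 \<le> 0)) \<and>
       (IFRA f F \<longleftrightarrow> 0 \<le> Q pstar * r (Q pstar) + ln (1 - pstar)))"
proof -
  interpret M: prob_space M by fact
  have X[measurable]: "X \<in> borel_measurable M"
    using assms(5) by (simp add: distributed_def)
  interpret real_distribution "distr M borel X" by (intro M.real_distribution_distr X)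
  have "(\<lambda>x. ennreal (f x)) \<in> borel_measurable borel"
    using assms(5) by (simp add: distributed_def)
  \<comment> \<open>Measurability is given only for \<open>ennreal (f x)\<close>; as
    \<open>f\<close> is nonnegative, \<open>enn2real\<close> recovers \<open>f\<close>.\<close>
  then have "(\<lambda>x. enn2real (ennreal (f x))) \<in> borel_measurable borel"
    by measurable
  then have f: "f \<in> borel_measurable borel" using assms(4) by simp
  have dens: "distr M borel X = density lborel (\<lambda>x. ennreal (f x))"
    using assms(5) by (simp add: distributed_def cong: distr_cong)
  have nonneg: "AE x in distr M borel X. 0 \<le> x"
    using assms(2) by (subst AE_distr_iff) auto
  interpret lifetime "distr M borel X" f F Q
    by unfold_locales (use assms(4,6,8,9,10) f dens nonneg in auto)
  note S = strict_support[OF assms(7)]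
  show ?thesis
    using upside_down_bathtub_ageing[OF assms(12) S assms(11)]
      bathtub_ageing[OF assms(12) S assms(11)] by blast
qed

end
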